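(* Let $N$ be a positive integer and let $M\ge 0$ be an integer. For every nonnegative integer $n$ there exists a bijection $\phi_M$ between $A_{M,N}(n)$ and $B_N(n)$.
   Context: A partition is a finite non-increasing sequence of positive integers (its parts); $|\lambda|$ denotes the sum of the parts of $\lambda$. $A_{M,N}(n)$ is the set of pairs of partitions $(\alpha,\beta)$ such that $\alpha$ has at most $N$ parts, each part of $\alpha$ not exceeding $M$, each part of $\beta$ lies in $[M+1,M+N]$, and $|\alpha|+|\beta|=n$. $B_N(n)$ is the set of partitions of $n$ with at most $N$ parts. *)

theory Defs
  imports Main
begin

definition is_partition :: "nat list \<Rightarrow> bool" where
  "is_partition xs \<longleftrightarrow> sorted_wrt (\<ge>) xs \<and> (\<forall>x\<in>set xs. 0 < x)"

definition A_set :: "nat \<Rightarrow> nat \<Rightarrow> nat \<Rightarrow> (nat list \<times> nat list) set" where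
  "A_set M N n = {(\<alpha>, \<beta>). is_partition \<alpha> \<and> is_partition \<beta> \<and>
     length \<alpha> \<le> N \<and> (\<forall>x\<in>set \<alpha>. x \<le> M) \<and>
     set \<beta> \<subseteq> {M + 1..M + N} \<and>
     sum_list \<alpha> + sum_list \<beta> = n}"

definition B_set :: "nat \<Rightarrow> nat \<Rightarrow> nat list set" where
  "B_set N n = {xs. is_partition xs \<and> sum_list xs = n \<and> length xs \<le> N}"

end

theory Submission
  imports Defs "HOL-Computational_Algebra.Formal_Power_Series"
begin

text \<open>
  Both sets are finite, so it suffices to compare cardinalities. For \<open>M \<ge> n\<close> the comparison is
  trivial: a part of \<open>\<beta>\<close> would exceed \<open>n\<close>, so \<open>\<beta>\<close> is empty, while the bound \<open>M\<close> on the parts of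
  \<open>\<alpha>\<close> is vacuous. It therefore remains to see that the number of pairs does not change when \<open>M\<close>
  is replaced by \<open>M + 1\<close>, and this is read off from generating functions.

  Write \<open>G(M, N)\<close> for the generating function of the partitions \<open>\<alpha>\<close> and \<open>H(S)\<close> for that of the
  partitions with parts in \<open>S\<close>, so that the pairs are counted by \<open>G(M, N) H([M+1, M+N])\<close>.
  For \<open>k \<notin> S\<close>, splitting off the parts equal to \<open>k\<close> gives \<open>(1 - q\<^sup>k) H(S \<union> {k}) = H(S)\<close>
  (\<open>gf_parts_in_insert\<close>); with \<open>S = [M+2, M+N]\<close>, which is contained in the intervals for both \<open>M\<close> and
  \<open>M + 1\<close>, the passage from \<open>M\<close> to \<open>M + 1\<close> multiplies \<open>H\<close> by
  \<open>(1 - q\<^bsup>M+1\<^esup>) / (1 - q\<^bsup>M+N+1\<^esup>)\<close>. The series \<open>G(M, N)\<close> is the Gaussian binomial coefficient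
  (\<open>gf_box_qpoch\<close>), which the same passage multiplies by the inverse of this factor.
\<close>

section \<open>Generating functions of weighted sets\<close>

text \<open>
  The generating function of a set \<open>X\<close> with respect to a weight \<open>w\<close>. It is meaningful only if each
  weight is attained finitely often on \<open>X\<close>, which the lemmas below assume where it is needed. The
  coefficients are integers, so that the series form an integral domain.
\<close>
definition gf :: "('a \<Rightarrow> nat) \<Rightarrow> 'a set \<Rightarrow> int fps" where
  "gf w X = Abs_fps (\<lambda>n. int (card {x\<in>X. w x = n}))"

lemma gf_nth [simp]: "fps_nth (gf w X) n = int (card {x\<in>X. w x = n})"
  by (simp add: gf_def)

lemma gf_Un_disjoint:
  assumes "X \<inter> Y = {}" "\<And>n. finite {x\<in>X. w x = n}" "\<And>n. finite {x\<in>Y. w x = n}"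
  shows "gf w (X \<union> Y) = gf w X + gf w Y"
proof (rule fps_ext)
  fix n
  have "{x\<in>X \<union> Y. w x = n} = {x\<in>X. w x = n} \<union> {x\<in>Y. w x = n}" by auto
  moreover have "{x\<in>X. w x = n} \<inter> {x\<in>Y. w x = n} = {}" using assms(1) by auto
  ultimately show "fps_nth (gf w (X \<union> Y)) n = fps_nth (gf w X + gf w Y) n"
    using assms(2,3) by (simp add: card_Un_disjoint)
qed

lemma gf_image_shift:
  assumes inj: "inj_on f X" and w: "\<And>x. x \<in> X \<Longrightarrow> w (f x) = k + w x"
  shows "gf w (f ` X) = fps_X ^ k * gf w X"
proof (rule fps_ext)
  fix n
  show "fps_nth (gf w (f ` X)) n = fps_nth (fps_X ^ k * gf w X) n"
  proof (cases "n < k")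
    case True
    then have "{y\<in>f ` X. w y = n} = {}" using w by auto
    then have "card {y\<in>f ` X. w y = n} = 0" by (simp only: card.empty)
    then show ?thesis using True by (simp add: fps_X_power_mult_nth)
  next
    case False
    then have "{y\<in>f ` X. w y = n} = f ` {x\<in>X. w x = n - k}" using w by auto
    moreover have "inj_on f {x\<in>X. w x = n - k}" using inj by (rule inj_on_subset) auto
    ultimately have "card {y\<in>f ` X. w y = n} = card {x\<in>X. w x = n - k}"
      by (simp add: card_image)
    then show ?thesis using False by (simp add: fps_X_power_mult_nth)
  qed
qed

lemma gf_Times:
  assumes "\<And>n. finite {x\<in>X. v x = n}" "\<And>n. finite {y\<in>Y. w y = n}"
  shows "gf (\<lambda>(x, y). v x + w y) (X \<times> Y) = gf v X * gf w Y"
proof (rule fps_ext)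
  fix n
  let ?L = "\<lambda>i. {x\<in>X. v x = i} \<times> {y\<in>Y. w y = n - i}"
  have "{p\<in>X \<times> Y. (case p of (x, y) \<Rightarrow> v x + w y) = n} = (\<Union>i\<in>{0..n}. ?L i)" by auto
  moreover have "card (\<Union>i\<in>{0..n}. ?L i) = (\<Sum>i\<in>{0..n}. card (?L i))"
    using assms by (intro card_UN_disjoint) auto
  ultimately show "fps_nth (gf (\<lambda>(x, y). v x + w y) (X \<times> Y)) n = fps_nth (gf v X * gf w Y) n"
    by (simp add: fps_mult_nth card_cartesian_product)
qed

lemma one_minus_fps_X_power_nonzero:
  assumes "k > 0"
  shows "1 - fps_X ^ k \<noteq> (0 :: int fps)"
proof
  assume "1 - fps_X ^ k = (0 :: int fps)"
  then have "fps_nth (1 - fps_X ^ k :: int fps) 0 = 0" by simp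
  then show False using assms by simp
qed

section \<open>Partitions with parts in a given set\<close>

lemma finite_partitions_of: "finite {xs. is_partition xs \<and> sum_list xs = n}"
proof (rule finite_subset)
  have len: "length xs \<le> sum_list xs" if "\<forall>x\<in>set xs. 0 < x" for xs :: "nat list"
    using that by (induction xs) auto
  show "{xs. is_partition xs \<and> sum_list xs = n} \<subseteq> {xs. set xs \<subseteq> {0..n} \<and> length xs \<le> n}"
    using len by (auto simp: is_partition_def member_le_sum_list)
  show "finite {xs. set xs \<subseteq> {0..n} \<and> length xs \<le> n}"
    by (rule finite_lists_length_le) simp
qed

lemma finite_level_partitions:
  assumes "\<And>x. x \<in> X \<Longrightarrow> is_partition x"
  shows "finite {x\<in>X. sum_list x = n}"
  by (rule finite_subset[OF _ finite_partitions_of[of n]]) (use assms in auto)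

text \<open>The partitions all of whose parts lie in \<open>S\<close>, each part being allowed to occur repeatedly.\<close>
definition parts_in :: "nat set \<Rightarrow> nat list set" where
  "parts_in S = {xs. is_partition xs \<and> set xs \<subseteq> S}"

lemma finite_level_parts_in: "finite {x\<in>parts_in S. sum_list x = n}"
  by (rule finite_level_partitions) (simp add: parts_in_def)

text \<open>
  Inserting a part into a weakly decreasing list at its proper place, by means of the library's
  insertion into weakly increasing lists.
\<close>
definition add_part :: "nat \<Rightarrow> nat list \<Rightarrow> nat list" where
  "add_part k xs = rev (insort k (rev xs))"

lemma is_partition_iff_sorted_rev:
  "is_partition xs \<longleftrightarrow> sorted (rev xs) \<and> (\<forall>x\<in>set xs. 0 < x)"
  by (simp add: is_partition_def sorted_wrt_rev)

lemma sum_list_add_part: "sum_list (add_part k xs) = k + sum_list xs"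
proof -
  have "sum_list (insort k ys) = k + sum_list ys" for ys :: "nat list"
    by (induction ys) auto
  then show ?thesis by (simp add: add_part_def sum_list_rev)
qed

lemma parts_in_containing:
  assumes "k > 0"
  shows "{xs\<in>parts_in (insert k S). k \<in> set xs} = add_part k ` parts_in (insert k S)"
proof (intro equalityI subsetI)
  fix xs assume xs: "xs \<in> {xs\<in>parts_in (insert k S). k \<in> set xs}"
  let ?ys = "rev (remove1 k (rev xs))"
  have "sorted (rev xs)" using xs by (simp add: parts_in_def is_partition_iff_sorted_rev)
  then have "xs = add_part k ?ys" using xs by (simp add: add_part_def insort_remove1)
  moreover have "?ys \<in> parts_in (insert k S)"
    using xs set_remove1_subset[of k "rev xs"]
    by (auto simp: parts_in_def is_partition_iff_sorted_rev sorted_remove1)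
  ultimately show "xs \<in> add_part k ` parts_in (insert k S)" by blast
next
  fix xs assume "xs \<in> add_part k ` parts_in (insert k S)"
  then show "xs \<in> {xs\<in>parts_in (insert k S). k \<in> set xs}"
    using assms
    by (auto simp: parts_in_def is_partition_iff_sorted_rev add_part_def sorted_insort
        set_insort_key)
qed

lemma inj_add_part: "inj (add_part k)"
proof (rule inj_on_inverseI)
  show "rev (remove1 k (rev (add_part k xs))) = xs" for xs
    by (simp add: add_part_def remove1_insort_key)
qed

text \<open>
  \<open>H(S \<union> {k}) = H(S) + q\<^sup>k H(S \<union> {k})\<close>: a partition counted on the left either has no part \<open>k\<close>,
  or one copy of \<open>k\<close> can be removed from it.
\<close>
lemma gf_parts_in_insert:
  assumes "k > 0" "k \<notin> S"
  shows "(1 - fps_X ^ k) * gf sum_list (parts_in (insert k S)) = gf sum_list (parts_in S)"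
proof -
  let ?P = "parts_in (insert k S)"
  have split: "?P = parts_in S \<union> {xs\<in>?P. k \<in> set xs}"
    by (auto simp: parts_in_def)
  have "gf sum_list ?P = gf sum_list (parts_in S) + gf sum_list {xs\<in>?P. k \<in> set xs}"
  proof (subst split, rule gf_Un_disjoint)
    show "parts_in S \<inter> {xs\<in>?P. k \<in> set xs} = {}" using assms(2) by (auto simp: parts_in_def)
    show "finite {x\<in>{xs\<in>?P. k \<in> set xs}. sum_list x = n}" for n
      by (rule finite_level_partitions) (simp add: parts_in_def)
  qed (rule finite_level_parts_in)
  also have "gf sum_list {xs\<in>?P. k \<in> set xs} = fps_X ^ k * gf sum_list ?P"
    unfolding parts_in_containing[OF assms(1)]
    by (rule gf_image_shift) (auto simp: sum_list_add_part intro: inj_on_subset[OF inj_add_part])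
  finally show ?thesis unfolding left_diff_distrib mult_1_left diff_eq_eq .
qed

section \<open>Partitions in a box\<close>

text \<open>
  The partitions with at most \<open>N\<close> parts, each at most \<open>M\<close>: those whose Young diagram fits into an
  \<open>N \<times> M\<close> rectangle.
\<close>
definition box :: "nat \<Rightarrow> nat \<Rightarrow> nat list set" where
  "box M N = {xs. is_partition xs \<and> length xs \<le> N \<and> (\<forall>x\<in>set xs. x \<le> M)}"

lemma finite_level_box: "finite {x\<in>box M N. sum_list x = n}"
  by (rule finite_level_partitions) (simp add: box_def)

lemma box_trivial: "box 0 N = {[]}" "box M 0 = {[]}"
proof -
  have "xs = []" if "xs \<in> box 0 N" for xs
    using that by (cases xs) (auto simp: box_def is_partition_def)
  then show "box 0 N = {[]}" by (auto simp: box_def is_partition_def)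
  show "box M 0 = {[]}" by (auto simp: box_def is_partition_def)
qed

lemma gf_Nil: "gf sum_list {[] :: nat list} = 1"
proof (rule fps_ext)
  fix n
  have "{x\<in>{[] :: nat list}. sum_list x = n} = (if n = 0 then {[]} else {})" by auto
  then show "fps_nth (gf sum_list {[] :: nat list}) n = fps_nth 1 n" by simp
qed

text \<open>
  The Pascal recursion of the Gaussian binomial coefficients: either no part equals \<open>M + 1\<close>, or a
  largest part \<open>M + 1\<close> can be removed.
\<close>
lemma gf_box_Suc_Suc:
  "gf sum_list (box (Suc M) (Suc N)) =
    gf sum_list (box M (Suc N)) + fps_X ^ Suc M * gf sum_list (box (Suc M) N)"
proof -
  have "box (Suc M) (Suc N) = box M (Suc N) \<union> (#) (Suc M) ` box (Suc M) N" (is "?L = ?R")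
  proof (intro equalityI subsetI)
    fix xs assume xs: "xs \<in> ?L"
    show "xs \<in> ?R"
    proof (cases xs)
      case Nil
      then show ?thesis by (simp add: box_def is_partition_def)
    next
      case (Cons y ys)
      show ?thesis
      proof (cases "y = Suc M")
        case True
        then show ?thesis using xs Cons by (auto simp: box_def is_partition_def)
      next
        case False
        then have "y \<le> M" using xs Cons by (auto simp: box_def)
        then show ?thesis using xs Cons by (fastforce simp: box_def is_partition_def)
      qed
    qed
  qed (auto simp: box_def is_partition_def)
  moreover have "gf sum_list (box M (Suc N) \<union> (#) (Suc M) ` box (Suc M) N) =
      gf sum_list (box M (Suc N)) + gf sum_list ((#) (Suc M) ` box (Suc M) N)"
  proof (rule gf_Un_disjoint)
    show "box M (Suc N) \<inter> (#) (Suc M) ` box (Suc M) N = {}" by (auto simp: box_def)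
    show "finite {x\<in>(#) (Suc M) ` box (Suc M) N. sum_list x = n}" for n
      by (rule finite_level_partitions) (auto simp: box_def is_partition_def)
  qed (rule finite_level_box)
  moreover have "gf sum_list ((#) (Suc M) ` box (Suc M) N) =
      fps_X ^ Suc M * gf sum_list (box (Suc M) N)"
    by (rule gf_image_shift) auto
  ultimately show ?thesis by simp
qed

text \<open>The finite \<open>q\<close>-Pochhammer symbol \<open>(q; q)\<^sub>n\<close>.\<close>
definition qpoch :: "nat \<Rightarrow> int fps" where
  "qpoch n = (\<Prod>i<n. 1 - fps_X ^ Suc i)"

lemma qpoch_0: "qpoch 0 = 1"
  by (simp add: qpoch_def)

lemma qpoch_Suc: "qpoch (Suc n) = qpoch n * (1 - fps_X ^ Suc n)"
  by (simp add: qpoch_def)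

lemma qpoch_nonzero: "qpoch n \<noteq> 0"
  unfolding qpoch_def using one_minus_fps_X_power_nonzero by (auto simp del: power_Suc)

text \<open>
  The product formula \<open>G(M, N) = (q; q)\<^bsub>M+N\<^esub> / ((q; q)\<^sub>M (q; q)\<^sub>N)\<close> of the Gaussian binomial
  coefficients, free of denominators. The Pascal recursion yields it by induction on \<open>M + N\<close>, since
  \<open>(1 - x) + x (1 - y) = 1 - x y\<close> with \<open>x = q\<^sup>M\<close> and \<open>y = q\<^sup>N\<close>.
\<close>
lemma gf_box_qpoch: "gf sum_list (box M N) * qpoch M * qpoch N = qpoch (M + N)"
proof (induction "M + N" arbitrary: M N)
  case 0
  then show ?case by (simp add: box_trivial gf_Nil qpoch_0)
next
  case (Suc s)
  show ?case
  proof (cases "M = 0 \<or> N = 0")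
    case True
    then show ?thesis by (auto simp: box_trivial gf_Nil qpoch_0)
  next
    case False
    then obtain m k where mk: "M = Suc m" "N = Suc k" by (meson not0_implies_Suc)
    let ?x = "fps_X ^ Suc m :: int fps" and ?y = "fps_X ^ Suc k :: int fps"
    have s: "s = m + Suc k" "s = Suc m + k" using Suc.hyps(2) mk by auto
    have 1: "gf sum_list (box m (Suc k)) * qpoch m * qpoch (Suc k) = qpoch s"
      using Suc.hyps(1)[of m "Suc k"] s(1) by simp
    have 2: "gf sum_list (box (Suc m) k) * qpoch (Suc m) * qpoch k = qpoch s"
      using Suc.hyps(1)[of "Suc m" k] s(2) by simp
    have "gf sum_list (box M N) * qpoch M * qpoch N =
        (gf sum_list (box m (Suc k)) * qpoch m * qpoch (Suc k)) * (1 - ?x) +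
        ?x * (gf sum_list (box (Suc m) k) * qpoch (Suc m) * qpoch k) * (1 - ?y)"
      unfolding mk gf_box_Suc_Suc qpoch_Suc by (simp only: algebra_simps)
    also have "\<dots> = qpoch s * (1 - ?x * ?y)"
      unfolding 1 2 by (simp only: algebra_simps mult_1_left mult_1_right)
    also have "?x * ?y = fps_X ^ Suc s"
      unfolding s(1) by (simp only: power_add[symmetric]) simp
    also have "qpoch s * (1 - fps_X ^ Suc s) = qpoch (M + N)"
      unfolding Suc.hyps(2)[symmetric] by (rule qpoch_Suc[symmetric])
    finally show ?thesis .
  qed
qed

lemma gf_box_Suc_left:
  "gf sum_list (box (Suc M) N) * (1 - fps_X ^ Suc M) =
    gf sum_list (box M N) * (1 - fps_X ^ Suc (M + N))"
proof -
  let ?c = "qpoch M * qpoch N"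
  have "gf sum_list (box (Suc M) N) * (1 - fps_X ^ Suc M) * ?c = qpoch (Suc (M + N))"
    using gf_box_qpoch[of "Suc M" N] by (simp only: qpoch_Suc mult_ac add_Suc)
  also have "\<dots> = gf sum_list (box M N) * (1 - fps_X ^ Suc (M + N)) * ?c"
    unfolding qpoch_Suc gf_box_qpoch[of M N, symmetric] by (simp only: mult_ac)
  finally show ?thesis
    by (simp only: mult_cancel_right mult_eq_0_iff qpoch_nonzero simp_thms)
qed

section \<open>Independence of the bound\<close>

lemma A_set_eq:
  "A_set M N n =
    {p\<in>box M N \<times> parts_in {M + 1..M + N}. (case p of (\<alpha>, \<beta>) \<Rightarrow> sum_list \<alpha> + sum_list \<beta>) = n}"
  by (auto simp: A_set_def box_def parts_in_def)

lemma card_A_set: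
  "int (card (A_set M N n)) =
    fps_nth (gf sum_list (box M N) * gf sum_list (parts_in {M + 1..M + N})) n"
  unfolding A_set_eq gf_Times[OF finite_level_box finite_level_parts_in, symmetric] gf_nth ..

lemma gf_pairs_Suc:
  assumes "N \<ge> 1"
  shows "gf sum_list (box (Suc M) N) * gf sum_list (parts_in {Suc M + 1..Suc M + N}) =
    gf sum_list (box M N) * gf sum_list (parts_in {M + 1..M + N})" (is "?G' * ?H' = ?G * ?H")
proof -
  let ?a = "1 - fps_X ^ Suc M :: int fps" and ?b = "1 - fps_X ^ Suc (M + N) :: int fps"
  \<comment> \<open>The two intervals of admissible parts differ from this one by one element each.\<close>
  let ?S = "{M + 2..M + N}"
  have int: "{M + 1..M + N} = insert (Suc M) ?S"
    "{Suc M + 1..Suc M + N} = insert (Suc (M + N)) ?S"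
    using assms by auto
  have "?a * ?H = gf sum_list (parts_in ?S)"
    unfolding int(1) by (rule gf_parts_in_insert) auto
  also have "\<dots> = ?b * ?H'"
    unfolding int(2) by (rule gf_parts_in_insert[symmetric]) auto
  finally have H: "?a * ?H = ?b * ?H'" .
  have "?a * ?b * (?G' * ?H') = (?G' * ?a) * (?b * ?H')" by (simp only: mult_ac)
  also have "\<dots> = (?G * ?b) * (?a * ?H)" unfolding gf_box_Suc_left H ..
  also have "\<dots> = ?a * ?b * (?G * ?H)" by (simp only: mult_ac)
  finally show ?thesis
    by (simp only: mult_cancel_left mult_eq_0_iff one_minus_fps_X_power_nonzero zero_less_Suc
        simp_thms)
qed

lemma card_A_set_add:
  assumes "N \<ge> 1"
  shows "card (A_set (M + k) N n) = card (A_set M N n)"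
proof (induction k)
  case (Suc k)
  have "int (card (A_set (Suc (M + k)) N n)) = int (card (A_set (M + k) N n))"
    by (simp only: card_A_set gf_pairs_Suc[OF assms])
  then show ?case using Suc by simp
qed simp

lemma A_set_large:
  assumes "n \<le> M"
  shows "A_set M N n = (\<lambda>\<alpha>. (\<alpha>, [])) ` B_set N n"
proof (intro equalityI subsetI)
  fix p assume "p \<in> A_set M N n"
  then obtain \<alpha> \<beta> where p: "p = (\<alpha>, \<beta>)" and A: "(\<alpha>, \<beta>) \<in> A_set M N n" by (cases p) auto
  have "\<beta> = []"
  proof (cases \<beta>)
    case (Cons b bs)
    then have "b > M" "b \<le> n" using A by (auto simp: A_set_def)
    then show ?thesis using assms by simp
  qed
  then show "p \<in> (\<lambda>\<alpha>. (\<alpha>, [])) ` B_set N n" using p A by (auto simp: A_set_def B_set_def)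
next
  fix p :: "nat list \<times> nat list" assume "p \<in> (\<lambda>\<alpha>. (\<alpha>, [])) ` B_set N n"
  then obtain \<alpha> where p: "p = (\<alpha>, [])" and B: "\<alpha> \<in> B_set N n" by auto
  have "x \<le> M" if "x \<in> set \<alpha>" for x
    using member_le_sum_list[OF that] B assms by (simp add: B_set_def)
  then show "p \<in> A_set M N n" using p B by (auto simp: A_set_def B_set_def is_partition_def)
qed

lemma finite_B_set: "finite (B_set N n)"
  by (rule finite_subset[OF _ finite_partitions_of[of n]]) (auto simp: B_set_def)

lemma finite_A_set: "finite (A_set M N n)"
proof (rule finite_subset)
  let ?P = "\<Union>i\<in>{0..n}. {xs. is_partition xs \<and> sum_list xs = i}"
  show "A_set M N n \<subseteq> ?P \<times> ?P" by (auto simp: A_set_def)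
  show "finite (?P \<times> ?P)" using finite_partitions_of by blast
qed

theorem theorem1p2:
  fixes M N n :: nat
  assumes "N \<ge> 1"
  shows "\<exists>\<phi>. bij_betw \<phi> (A_set M N n) (B_set N n)"
proof (rule finite_same_card_bij[OF finite_A_set finite_B_set])
  have "card (A_set M N n) = card (A_set (M + n) N n)"
    by (rule card_A_set_add[OF assms, symmetric])
  also have "\<dots> = card (B_set N n)"
    by (simp add: A_set_large card_image inj_on_def)
  finally show "card (A_set M N n) = card (B_set N n)" .
qed

end
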